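(* Let $\mu>0$, $\theta>0$, $\alpha<-2$ be real numbers, let $d(p)=\mu\,\dfrac{e^{-(\alpha+\theta p)}}{1+e^{-(\alpha+\theta p)}}$ be the logit demand function, and let $R(p)=p\,d(p)$ be the corresponding revenue function, for prices $p\ge 0$. Let $p^*$ be the revenue-maximizing price, i.e. the maximizer of $R$ over $[0,\infty)$, and let $p_{\mathrm{inf}}$ be the price associated with the inflection point of $d$. Then $p^*<p_{\mathrm{inf}}$.
   Context: The feasible price domain is $p\ge 0$. The inflection point price $p_{\mathrm{inf}}$ is the price at which $d''(p)=0$; explicitly, $p_{\mathrm{inf}}=-\alpha/\theta$. *)

theory Defs
  imports "HOL-Analysis.Analysis"
begin

definition logit_demand :: "real \<Rightarrow> real \<Rightarrow> real \<Rightarrow> real \<Rightarrow> real" where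
  "logit_demand \<mu> \<alpha> \<theta> p = \<mu> * (exp (- (\<alpha> + \<theta> * p)) / (1 + exp (- (\<alpha> + \<theta> * p))))"

definition revenue :: "(real \<Rightarrow> real) \<Rightarrow> real \<Rightarrow> real" where
  "revenue d p = p * d p"

end

theory Submission
  imports Defs
begin

text \<open>
  Writing \<open>E = exp (- (\<alpha> + \<theta> p))\<close>, the second derivative of the demand has the sign of \<open>1 - E\<close>,
  so the inflection point satisfies \<open>\<alpha> + \<theta> p = 0\<close>. The maximizer of the revenue is interior,
  and its first-order condition reduces to \<open>1 + E = \<theta> p\<close>. At or beyond the inflection point
  \<open>E \<le> 1\<close> while \<open>\<theta> p \<ge> -\<alpha> > 2\<close>, so the condition cannot hold there.
\<close>

lemma logit_demand_has_real_derivative: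
  "(logit_demand \<mu> \<alpha> \<theta> has_real_derivative
     - (\<mu> * \<theta> * exp (- (\<alpha> + \<theta> * p)) / (1 + exp (- (\<alpha> + \<theta> * p)))\<^sup>2)) (at p)"
proof -
  have pos: "1 + exp (- (\<alpha> + \<theta> * p)) \<noteq> 0"
    by (metis add_pos_pos exp_gt_zero less_irrefl zero_less_one)
  show ?thesis
    unfolding logit_demand_def[abs_def]
    by (rule derivative_eq_intros refl pos)+
      (use pos in \<open>simp add: field_simps power2_eq_square\<close>)
qed

text \<open>Differentiating the quotient leaves a common factor \<open>1 + E\<close>, which cancels
  from the fourth power in the denominator. In this factored form, for nonzero \<mu> and \<theta>,
  only \<open>1 - E\<close> can vanish.\<close>

lemma deriv_deriv_logit_demand:
  "deriv (deriv (logit_demand \<mu> \<alpha> \<theta>)) p =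
     \<mu> * \<theta>\<^sup>2 * exp (- (\<alpha> + \<theta> * p)) * (1 - exp (- (\<alpha> + \<theta> * p))) / (1 + exp (- (\<alpha> + \<theta> * p))) ^ 3"
proof -
  have pos: "1 + exp (- (\<alpha> + \<theta> * p)) \<noteq> 0"
    by (metis add_pos_pos exp_gt_zero less_irrefl zero_less_one)
  then have pos2: "(1 + exp (- (\<alpha> + \<theta> * p)))\<^sup>2 \<noteq> 0"
    by simp
  have "deriv (logit_demand \<mu> \<alpha> \<theta>) =
      (\<lambda>p. - (\<mu> * \<theta> * exp (- (\<alpha> + \<theta> * p)) / (1 + exp (- (\<alpha> + \<theta> * p)))\<^sup>2))"
    using DERIV_imp_deriv[OF logit_demand_has_real_derivative] by blast
  moreover have "((\<lambda>p. - (\<mu> * \<theta> * exp (- (\<alpha> + \<theta> * p)) / (1 + exp (- (\<alpha> + \<theta> * p)))\<^sup>2))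
      has_real_derivative
      \<mu> * \<theta>\<^sup>2 * exp (- (\<alpha> + \<theta> * p)) * (1 - exp (- (\<alpha> + \<theta> * p))) / (1 + exp (- (\<alpha> + \<theta> * p))) ^ 3) (at p)"
    by (rule derivative_eq_intros refl pos2)+
      (use pos in \<open>simp add: divide_simps, simp add: algebra_simps eval_nat_numeral\<close>)
  ultimately show ?thesis
    by (simp add: DERIV_imp_deriv)
qed

theorem proposition4:
  fixes \<mu> \<theta> \<alpha> p_star p_inf :: real
  assumes "\<mu> > 0" and "\<theta> > 0" and "\<alpha> < -2"
    and "is_arg_max (revenue (logit_demand \<mu> \<alpha> \<theta>)) (\<lambda>p. p \<ge> 0) p_star"
    and "deriv (deriv (logit_demand \<mu> \<alpha> \<theta>)) p_inf = 0"
  shows "p_star < p_inf"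
proof -
  let ?d = "logit_demand \<mu> \<alpha> \<theta>"
  let ?R = "revenue ?d"
  define E where "E = exp (- (\<alpha> + \<theta> * p_star))"
  have E_pos: "E > 0"
    by (simp add: E_def)
  \<comment> \<open>Excludes a quotient that is zero only because \<open>x / 0 = 0\<close>.\<close>
  have "1 + exp (- (\<alpha> + \<theta> * p_inf)) > 0"
    by (simp add: add_pos_pos)
  then have "exp (- (\<alpha> + \<theta> * p_inf)) = 1"
    using assms(1,2,5) unfolding deriv_deriv_logit_demand by auto
  then have inflection: "\<alpha> + \<theta> * p_inf = 0"
    by (metis exp_eq_one_iff neg_equal_0_iff_equal)
  have nonneg: "p_star \<ge> 0" and max: "\<And>p. p \<ge> 0 \<Longrightarrow> ?R p \<le> ?R p_star"
    using assms(4) unfolding is_arg_max_def by (auto simp: not_less)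
  \<comment> \<open>Revenue vanishes at price 0, so any positive price, here 1, shows that the
    maximum is not at the boundary.\<close>
  have "0 < ?R 1"
    using assms(1) by (simp add: revenue_def logit_demand_def add_pos_pos)
  then have "p_star \<noteq> 0"
    using max[of 1] by (auto simp: revenue_def)
  with nonneg have pos: "p_star > 0"
    by simp
  have "(?R has_real_derivative
      ?d p_star + p_star * - (\<mu> * \<theta> * E / (1 + E)\<^sup>2)) (at p_star)"
    unfolding revenue_def[abs_def] E_def
    by (rule derivative_eq_intros logit_demand_has_real_derivative refl)+ simp
  \<comment> \<open>The radius \<open>p_star\<close> keeps the neighbourhood inside the feasible
    prices, making the constrained maximum a local one on the whole line.\<close>
  moreover have "\<forall>p. \<bar>p_star - p\<bar> < p_star \<longrightarrow> ?R p \<le> ?R p_star"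
    using max by auto
  ultimately have "?d p_star + p_star * - (\<mu> * \<theta> * E / (1 + E)\<^sup>2) = 0"
    using pos DERIV_local_max by blast
  moreover have "?d p_star + p_star * - (\<mu> * \<theta> * E / (1 + E)\<^sup>2)
      = \<mu> * E * (1 + E - \<theta> * p_star) / (1 + E)\<^sup>2"
    using E_pos unfolding logit_demand_def E_def[symmetric]
    by (simp add: divide_simps power2_eq_square) (simp add: algebra_simps)
  ultimately have "\<mu> * E * (1 + E - \<theta> * p_star) / (1 + E)\<^sup>2 = 0"
    by simp
  then have foc: "1 + E = \<theta> * p_star"
    using assms(1) E_pos by auto
  show ?thesis
  proof (rule ccontr)
    assume "\<not> p_star < p_inf"
    then have "\<theta> * p_inf \<le> \<theta> * p_star"
      using assms(2) by simp
    with inflection have "\<alpha> + \<theta> * p_star \<ge> 0"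
      by linarith
    moreover from this have "E \<le> 1"
      by (simp add: E_def)
    \<comment> \<open>The threshold -2 comes from the inflection point, where \<open>1 + E\<close>
      is exactly 2 and \<theta> times the price is -\<alpha>.\<close>
    ultimately show False
      using foc assms(3) by linarith
  qed
qed

end
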